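(* Let $\alpha_0,\alpha_1,\alpha_2,\alpha_3$ be complex parameters with $\alpha_0+2\alpha_1+2\alpha_2+\alpha_3=1$ and consider the Hamiltonian system $$\frac{dx}{dt}=\frac{\partial H}{\partial y},\quad \frac{dy}{dt}=-\frac{\partial H}{\partial x},\quad \frac{dz}{dt}=\frac{\partial H}{\partial w},\quad \frac{dw}{dt}=-\frac{\partial H}{\partial z}$$ with $$\begin{aligned} t^2H =\;&x^2y^3-(tx+2\alpha_1+\alpha_2+\alpha_3)xy^2-\{(\alpha_0 t-1)x-\alpha_1(\alpha_1+\alpha_2+\alpha_3)\}y-tx\\ &-\frac{z^2w^4}{4}+\frac{\alpha_3}{2}zw^3+\frac{1}{4}(2tz^2-\alpha_3^2)w^2-\frac{1}{2}\{(\alpha_3+1)t-1\}zw-\frac{t^2 z^2}{4}\\ &+(xy-\alpha_1)yzw. \end{aligned}$$ This system has the following invariant divisors: $f_1:=x$ when $\alpha_1=0$; $f_2:=y+w^2-t$ when $\alpha_2=0$; $f_3:=z$ when $\alpha_3=0$.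
   Context: A polynomial $f\in\mathbb{C}(t)[x,y,z,w]$ is an invariant divisor of the system (for given parameter values) if its derivative along the flow, $\frac{\partial f}{\partial t}+\frac{\partial H}{\partial y}\frac{\partial f}{\partial x}-\frac{\partial H}{\partial x}\frac{\partial f}{\partial y}+\frac{\partial H}{\partial w}\frac{\partial f}{\partial z}-\frac{\partial H}{\partial z}\frac{\partial f}{\partial w}$, is divisible by $f$ in $\mathbb{C}(t)[x,y,z,w]$; i.e. the hypersurface $f=0$ is invariant under the system. *)

theory Defs
  imports
    "HOL-Library.Poly_Mapping"
    "HOL-Computational_Algebra.Computational_Algebra"
begin

type_synonym ratfun = "complex poly fract"

definition cst :: "complex \<Rightarrow> ratfun" where
  "cst c = to_fract [:c:]"

definition tvar :: ratfun where
  "tvar = to_fract [:0, 1:]"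

(* d/dt on \<complex>(t), by the quotient rule on an arbitrary representative a/b; the next two
   lemmas show that the result does not depend on the representative *)
definition ratfun_deriv :: "ratfun \<Rightarrow> ratfun" where
  "ratfun_deriv q =
     (THE r. \<exists>a b. b \<noteq> 0 \<and> q = Fract a b \<and> r = Fract (pderiv a * b - a * pderiv b) (b ^ 2))"

lemma quotient_rule_well_defined:
  fixes a b c d :: "complex poly"
  assumes nz: "b \<noteq> 0" "d \<noteq> 0" and "Fract a b = Fract c d"
  shows "Fract (pderiv a * b - a * pderiv b) (b ^ 2) = Fract (pderiv c * d - c * pderiv d) (d ^ 2)"
proof -
  have eq: "c * b = a * d"
    using assms by (simp add: eq_fract)
  have "pderiv (c * b) = pderiv (a * d)"
    by (simp only: eq)
  then have deq: "c * pderiv b + b * pderiv c = a * pderiv d + d * pderiv a"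
    by (simp only: pderiv_mult)
  have "(pderiv a * b - a * pderiv b) * d ^ 2 = (pderiv c * d - c * pderiv d) * b ^ 2"
  proof -
    have "(pderiv a * b - a * pderiv b) * d ^ 2 - (pderiv c * d - c * pderiv d) * b ^ 2 =
        b * d * ((a * pderiv d + d * pderiv a) - (c * pderiv b + b * pderiv c))
        + (d * pderiv b + b * pderiv d) * (c * b - a * d)"
      by (simp add: algebra_simps power2_eq_square)
    then show ?thesis
      by (simp only: eq deq) simp
  qed
  then show ?thesis
    using nz by (simp add: eq_fract)
qed

lemma ratfun_deriv_Fract:
  assumes "b \<noteq> 0"
  shows "ratfun_deriv (Fract a b) = Fract (pderiv a * b - a * pderiv b) (b ^ 2)"
  unfolding ratfun_deriv_def
proof (rule the_equality)
  show "\<exists>a' b'. b' \<noteq> 0 \<and> Fract a b = Fract a' b' \<and>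
      Fract (pderiv a * b - a * pderiv b) (b ^ 2) = Fract (pderiv a' * b' - a' * pderiv b') (b' ^ 2)"
    using assms by (intro exI conjI) (assumption | rule refl)+
next
  fix r
  assume "\<exists>a' b'. b' \<noteq> 0 \<and> Fract a b = Fract a' b' \<and>
      r = Fract (pderiv a' * b' - a' * pderiv b') (b' ^ 2)"
  then obtain a' b' where "b' \<noteq> 0" "Fract a b = Fract a' b'"
      "r = Fract (pderiv a' * b' - a' * pderiv b') (b' ^ 2)"
    by (elim exE conjE)
  with quotient_rule_well_defined[OF assms, of b' a a']
  show "r = Fract (pderiv a * b - a * pderiv b) (b ^ 2)"
    by (simp only: simp_thms)
qed

datatype var = X | Y | Z | W

(* \<complex>(t)[x,y,z,w]: finitely supported maps from exponent vectors to coefficients;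
   the library's multiplication on this type is convolution *)
type_synonym mpoly4 = "(var \<Rightarrow>\<^sub>0 nat) \<Rightarrow>\<^sub>0 ratfun"

definition Var :: "var \<Rightarrow> mpoly4" where
  "Var v = Poly_Mapping.single (Poly_Mapping.single v 1) 1"

definition Coeff :: "ratfun \<Rightarrow> mpoly4" where
  "Coeff q = Poly_Mapping.single 0 q"

definition partial :: "var \<Rightarrow> mpoly4 \<Rightarrow> mpoly4" where
  "partial v p =
     (\<Sum>m\<in>Poly_Mapping.keys p.
        Poly_Mapping.single (m - Poly_Mapping.single v 1)
          (of_nat (Poly_Mapping.lookup m v) * Poly_Mapping.lookup p m))"

definition partial_t :: "mpoly4 \<Rightarrow> mpoly4" where
  "partial_t p = Poly_Mapping.map ratfun_deriv p"

definition flow_deriv :: "mpoly4 \<Rightarrow> mpoly4 \<Rightarrow> mpoly4" where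
  "flow_deriv H f =
     partial_t f
     + partial Y H * partial X f - partial X H * partial Y f
     + partial W H * partial Z f - partial Z H * partial W f"

definition invariant_divisor :: "mpoly4 \<Rightarrow> mpoly4 \<Rightarrow> bool" where
  "invariant_divisor H f \<longleftrightarrow> f dvd flow_deriv H f"

definition hamiltonian :: "complex \<Rightarrow> complex \<Rightarrow> complex \<Rightarrow> complex \<Rightarrow> mpoly4" where
  "hamiltonian \<alpha>0 \<alpha>1 \<alpha>2 \<alpha>3 =
     (let x = Var X; y = Var Y; z = Var Z; w = Var W; t = Coeff tvar;
          C = (\<lambda>c. Coeff (cst c))
      in Coeff (inverse (tvar ^ 2)) *
         (x^2 * y^3 - (t * x + C (2*\<alpha>1 + \<alpha>2 + \<alpha>3)) * x * y^2
          - ((C \<alpha>0 * t - 1) * x - C (\<alpha>1 * (\<alpha>1 + \<alpha>2 + \<alpha>3))) * y - t * x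
          - C (1/4) * z^2 * w^4 + C (\<alpha>3/2) * z * w^3
          + C (1/4) * (2 * t * z^2 - C (\<alpha>3^2)) * w^2
          - C (1/2) * (C (\<alpha>3 + 1) * t - 1) * z * w
          - C (1/4) * t^2 * z^2
          + (x * y - C \<alpha>1) * y * z * w))"

end

theory Submission
  imports Defs
begin

text \<open>
  The derivative of a function $f$ along the flow can be computed by hand from the partial
  derivatives of $H$, and in each of the three cases it visibly splits off the factor $f$.

  For $f = x$ it is $\partial H/\partial y$. The terms of $H$ that contain $y$ but not $x$ are
  $\alpha_1(\alpha_1+\alpha_2+\alpha_3)y/t^2$ and $-\alpha_1yzw/t^2$, so everything that is left
  for $\alpha_1 = 0$ is a multiple of $x$.
  For $f = z$ it is $\partial H/\partial w$. The only term of $H$ that contains $w$ but not $z$ is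
  $-\alpha_3^2w^2/(4t^2)$, so everything that is left for $\alpha_3 = 0$ is a multiple of $z$.

  For $f = y + w^2 - t$ the derivative is
  $-1 - \partial H/\partial x - 2w\,\partial H/\partial z$. Multiplied by $-t^2$ this becomes a
  polynomial in $x, y, z, w, t$. The part that contains $x$ is $2xy^2f$; the part that contains $z$ is
  $zw(y^2 - (w^2-t)^2) = zw(y - w^2 + t)f$; and the rest is a quadratic polynomial in $y$ and $w^2$,
  which has $f$ as a factor because of the relation
  $\alpha_0 + 2\alpha_1 + \alpha_3 = 1$ between the parameters
  (lemma \<open>cofactor_identity\<close>).

  What turns these calculations into proofs is that \<^const>\<open>partial\<close> satisfies the
  Leibniz rule (lemma \<open>partial_mult\<close>) and that \<^const>\<open>partial_t\<close> is additive, so that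
  both can be evaluated on polynomial expressions instead of on coefficient functions.
\<close>

section \<open>The partial derivatives are derivations\<close>

text \<open>
  The sum in the definition ranges over the support of the polynomial, and the supports of $p$, $q$
  and $p + q$ differ. Extending all three sums to a common index set makes additivity a termwise
  statement.
\<close>
lemma partial_eq_sum_superset:
  assumes "finite S" "Poly_Mapping.keys p \<subseteq> S"
  shows "partial v p =
     (\<Sum>m\<in>S. Poly_Mapping.single (m - Poly_Mapping.single v 1)
          (of_nat (Poly_Mapping.lookup m v) * Poly_Mapping.lookup p m))"
  unfolding partial_def using assms
  by (intro sum.mono_neutral_left) (auto simp: in_keys_iff)

lemma partial_add: "partial v (p + q) = partial v p + partial v q"
proof -
  let ?S = "Poly_Mapping.keys p \<union> Poly_Mapping.keys q"
  have S: "finite ?S" "Poly_Mapping.keys p \<subseteq> ?S" "Poly_Mapping.keys q \<subseteq> ?S"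
      "Poly_Mapping.keys (p + q) \<subseteq> ?S"
    using Poly_Mapping.keys_add[of p q] by auto
  show ?thesis
    by (simp add: partial_eq_sum_superset[OF S(1) S(2)] partial_eq_sum_superset[OF S(1) S(3)]
        partial_eq_sum_superset[OF S(1) S(4)] lookup_add distrib_left single_add sum.distrib)
qed

lemma partial_zero [simp]: "partial v 0 = 0"
  by (simp add: partial_def)

lemma partial_uminus: "partial v (- p) = - partial v p"
  using partial_add[of v p "- p"] by (simp add: eq_neg_iff_add_eq_0 add.commute)

lemma partial_diff: "partial v (p - q) = partial v p - partial v q"
  using partial_add[of v p "- q"] by (simp add: partial_uminus)

lemma partial_single:
  "partial v (Poly_Mapping.single m c) =
     Poly_Mapping.single (m - Poly_Mapping.single v 1) (of_nat (Poly_Mapping.lookup m v) * c)"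
  by (cases "c = 0") (simp_all add: partial_def)

text \<open>
  Additive identities need to be checked on monomials only.
\<close>
lemma poly_mapping_monomial_induct [case_names zero add]:
  fixes p :: "'a \<Rightarrow>\<^sub>0 'b::comm_monoid_add"
  assumes "P 0" and "\<And>m c q. P q \<Longrightarrow> P (Poly_Mapping.single m c + q)"
  shows "P p"
proof (induction p rule: Poly_Mapping.update_induct)
  case const
  show ?case by (rule assms(1))
next
  case (update q m c)
  have "Poly_Mapping.update m c q = Poly_Mapping.single m c + q"
    using update(1)
    by (intro poly_mapping_eqI) (auto simp: lookup_update lookup_add lookup_single in_keys_iff)
  then show ?case using assms(2) update by simp
qed

text \<open>
  Subtraction of exponents is truncated, so moving it across an addition is safe when the
  variable really occurs in the monomial that it is applied to.
\<close>
lemma shift_exponent: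
  fixes a b :: "'a \<Rightarrow>\<^sub>0 nat"
  assumes "Poly_Mapping.lookup a v > 0"
  shows "a + b - Poly_Mapping.single v 1 = (a - Poly_Mapping.single v 1) + b"
  using assms
  by (intro poly_mapping_eqI) (auto simp: lookup_add lookup_minus lookup_single when_def)

lemma partial_mult_single:
  "partial v (Poly_Mapping.single a c * Poly_Mapping.single b d) =
     partial v (Poly_Mapping.single a c) * Poly_Mapping.single b d
     + Poly_Mapping.single a c * partial v (Poly_Mapping.single b d)"
proof -
  let ?e = "Poly_Mapping.single v (1::nat)"
  let ?la = "Poly_Mapping.lookup a v" and ?lb = "Poly_Mapping.lookup b v"
  have "partial v (Poly_Mapping.single a c * Poly_Mapping.single b d) =
      Poly_Mapping.single (a + b - ?e) (of_nat ?la * c * d)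
      + Poly_Mapping.single (a + b - ?e) (c * (of_nat ?lb * d))"
    by (simp add: mult_single partial_single lookup_add algebra_simps flip: single_add)
  \<comment> \<open>If the variable does not occur in one of the factors, then the exponents of the two
      sides may differ because of truncation, but the coefficient is zero.\<close>
  also have "Poly_Mapping.single (a + b - ?e) (of_nat ?la * c * d) =
      Poly_Mapping.single ((a - ?e) + b) (of_nat ?la * c * d)"
    using shift_exponent[of a v b] by (cases "?la = 0") auto
  also have "Poly_Mapping.single (a + b - ?e) (c * (of_nat ?lb * d)) =
      Poly_Mapping.single (a + (b - ?e)) (c * (of_nat ?lb * d))"
    using shift_exponent[of b v a] by (cases "?lb = 0") (auto simp: add.commute)
  finally show ?thesis
    by (simp add: mult_single partial_single)
qed

lemma partial_mult: "partial v (p * q) = partial v p * q + p * partial v q"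
proof (induction p rule: poly_mapping_monomial_induct)
  case (add a c p)
  have "partial v (Poly_Mapping.single a c * q) =
      partial v (Poly_Mapping.single a c) * q + Poly_Mapping.single a c * partial v q"
    by (induction q rule: poly_mapping_monomial_induct)
       (simp_all add: distrib_left partial_add partial_mult_single)
  with add show ?case
    by (simp add: distrib_right partial_add)
qed simp

lemma partial_Coeff [simp]: "partial v (Coeff q) = 0"
  by (simp add: Coeff_def partial_single)

lemma partial_Var: "partial v (Var u) = (if u = v then 1 else 0)"
  by (simp add: Var_def partial_single lookup_single)

lemma partial_of_nat [simp]: "partial v (of_nat n) = 0"
  using partial_Coeff[of v "of_nat n"] by (simp add: Coeff_def)

lemma partial_one [simp]: "partial v 1 = 0"
  using partial_of_nat[of v 1] by simp

lemma partial_numeral [simp]: "partial v (numeral n) = 0"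
  using partial_of_nat[of v "numeral n"] by simp

lemma partial_power: "partial v (p ^ n) = of_nat n * p ^ (n - 1) * partial v p"
proof (induction n)
  case (Suc n)
  then show ?case by (cases n) (simp_all add: partial_mult algebra_simps)
qed simp

lemmas partial_rules = partial_add partial_diff partial_mult partial_power partial_Var

section \<open>The derivative in the time variable\<close>

lemma ratfun_deriv_add: "ratfun_deriv (p + q) = ratfun_deriv p + ratfun_deriv q"
proof -
  obtain a b where p: "p = Fract a b" "b \<noteq> 0" by (cases p) auto
  obtain c d where q: "q = Fract c d" "d \<noteq> 0" by (cases q) auto
  show ?thesis
    using p q by (simp add: ratfun_deriv_Fract eq_fract pderiv_add pderiv_mult power2_eq_square
        algebra_simps)
qed

lemma ratfun_deriv_to_fract [simp]: "ratfun_deriv (to_fract a) = to_fract (pderiv a)"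
  by (simp add: to_fract_def ratfun_deriv_Fract)

lemma ratfun_deriv_0 [simp]: "ratfun_deriv 0 = 0"
  using ratfun_deriv_to_fract[of 0] by simp

lemma ratfun_deriv_1 [simp]: "ratfun_deriv 1 = 0"
  using ratfun_deriv_to_fract[of 1] by simp

lemma lookup_partial_t:
  "Poly_Mapping.lookup (partial_t p) m = ratfun_deriv (Poly_Mapping.lookup p m)"
  by (simp add: partial_t_def Poly_Mapping.map.rep_eq when_def)

lemma partial_t_add: "partial_t (p + q) = partial_t p + partial_t q"
  by (intro poly_mapping_eqI) (simp add: lookup_partial_t lookup_add ratfun_deriv_add)

lemma partial_t_diff: "partial_t (p - q) = partial_t p - partial_t q"
  using partial_t_add[of "p - q" q] by simp

lemma partial_t_single:
  "partial_t (Poly_Mapping.single m c) = Poly_Mapping.single m (ratfun_deriv c)"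
  by (intro poly_mapping_eqI) (simp add: lookup_partial_t lookup_single when_def)

text \<open>
  A power of a variable is a monomial with coefficient 1. Only sums of such powers and of
  coefficients are differentiated with respect to time, so additivity takes the place of a Leibniz
  rule for \<^const>\<open>partial_t\<close>.
\<close>
lemma partial_t_Var_power [simp]: "partial_t (Var v ^ n) = 0"
proof -
  have "\<exists>m. Var v ^ n = Poly_Mapping.single m 1"
    by (induction n) (auto simp: Var_def mult_single simp flip: single_one)
  then show ?thesis by (auto simp: partial_t_single)
qed

lemma partial_t_Var [simp]: "partial_t (Var v) = 0"
  using partial_t_Var_power[of v 1] by simp

lemma partial_t_tvar [simp]: "partial_t (Coeff tvar) = 1"
proof -
  have "ratfun_deriv tvar = 1"
    by (simp add: tvar_def pderiv_pCons flip: one_pCons)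
  then show ?thesis by (simp add: Coeff_def partial_t_single)
qed

section \<open>Constants\<close>

abbreviation const :: "complex \<Rightarrow> mpoly4" where
  "const c \<equiv> Coeff (cst c)"

lemma Coeff_mult: "Coeff (p * q) = Coeff p * Coeff q"
  by (simp add: Coeff_def mult_single)

lemma const_add: "const (a + b) = const a + const b"
proof -
  have "cst (a + b) = cst a + cst b"
    by (simp add: cst_def flip: to_fract_add)
  then show ?thesis by (simp add: Coeff_def single_add)
qed

lemma const_mult: "const (a * b) = const a * const b"
proof -
  have "cst (a * b) = cst a * cst b"
    by (simp add: cst_def mult.commute flip: to_fract_mult)
  then show ?thesis by (simp add: Coeff_mult)
qed

lemma const_0 [simp]: "const 0 = 0"
  by (simp add: Coeff_def cst_def)

lemma const_1 [simp]: "const 1 = 1"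
  by (simp add: Coeff_def cst_def flip: one_pCons)

lemma const_of_nat: "const (of_nat n) = of_nat n"
  by (induction n) (simp_all add: const_add)

lemma const_numeral [simp]: "const (numeral n) = numeral n"
  using const_of_nat[of "numeral n"] by simp

lemma const_power: "const (a ^ n) = const a ^ n"
  by (induction n) (simp_all add: const_mult)

lemma Coeff_inverse_tvar: "Coeff (inverse (tvar ^ 2)) * Coeff tvar ^ 2 = 1"
proof -
  have "tvar \<noteq> 0" by (simp add: tvar_def)
  then have "Coeff (inverse (tvar ^ 2) * tvar ^ 2) = 1"
    by (simp add: Coeff_def)
  then show ?thesis by (simp add: Coeff_mult power2_eq_square)
qed

text \<open>
  The Hamiltonian has the numerical denominators 2 and 4, and normalization of polynomial expressions
  cannot cancel them, because they are constant polynomials and not numerals. As 4 is a unit,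
  divisibility may be tested after multiplication by 4, where all numerical coefficients are integers.
\<close>
lemma dvd_if_dvd_4_mult:
  fixes f p :: mpoly4
  assumes "f dvd 4 * p"
  shows "f dvd p"
proof -
  have "const (1/4) * 4 = 1"
    by (simp flip: const_numeral const_mult)
  then have "p = const (1/4) * (4 * p)"
    by (simp flip: mult.assoc)
  with assms show ?thesis
    by (metis dvd_mult)
qed

section \<open>The gradient of the Hamiltonian\<close>

abbreviation "x \<equiv> Var X"
abbreviation "y \<equiv> Var Y"
abbreviation "z \<equiv> Var Z"
abbreviation "w \<equiv> Var W"
abbreviation "t \<equiv> Coeff tvar"
abbreviation "t_inv2 \<equiv> Coeff (inverse (tvar ^ 2))"

lemma four_hamiltonian:
  "4 * hamiltonian \<alpha>0 \<alpha>1 \<alpha>2 \<alpha>3 =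
     t_inv2 * (4 * x^2 * y^3 - 4 * (t * x + const (2*\<alpha>1 + \<alpha>2 + \<alpha>3)) * x * y^2
          - 4 * ((const \<alpha>0 * t - 1) * x - const \<alpha>1 * const (\<alpha>1 + \<alpha>2 + \<alpha>3)) * y - 4 * t * x
          - z^2 * w^4 + 2 * const \<alpha>3 * z * w^3
          + (2 * t * z^2 - const \<alpha>3 ^ 2) * w^2
          - 2 * ((const \<alpha>3 + 1) * t - 1) * z * w
          - t^2 * z^2
          + 4 * (x * y - const \<alpha>1) * y * z * w)"
proof -
  have fractions: "4 * const (1/4) = 1" "4 * const (1/2) = 2" "4 * const (\<alpha>3/2) = 2 * const \<alpha>3"
    by (simp_all flip: const_numeral const_mult)
  have "4 * hamiltonian \<alpha>0 \<alpha>1 \<alpha>2 \<alpha>3 =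
     t_inv2 * (4 * x^2 * y^3 - 4 * (t * x + const (2*\<alpha>1 + \<alpha>2 + \<alpha>3)) * x * y^2
          - 4 * ((const \<alpha>0 * t - 1) * x - const \<alpha>1 * const (\<alpha>1 + \<alpha>2 + \<alpha>3)) * y - 4 * t * x
          - (4 * const (1/4)) * z^2 * w^4 + (4 * const (\<alpha>3/2)) * z * w^3
          + (4 * const (1/4)) * (2 * t * z^2 - const \<alpha>3 ^ 2) * w^2
          - (4 * const (1/2)) * ((const \<alpha>3 + 1) * t - 1) * z * w
          - (4 * const (1/4)) * t^2 * z^2
          + 4 * (x * y - const \<alpha>1) * y * z * w)"
    unfolding hamiltonian_def Let_def const_power const_add const_mult const_1
    by (simp only: algebra_simps)
  then show ?thesis
    by (simp only: fractions mult_1)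
qed

lemma four_partial: "4 * partial v p = partial v (4 * p)"
  by (simp add: partial_mult)

lemma four_partial_X_hamiltonian:
  "4 * partial X (hamiltonian \<alpha>0 \<alpha>1 \<alpha>2 \<alpha>3) =
     4 * t_inv2 * (2 * x * y^3 - 2 * t * x * y^2 - const (2*\<alpha>1 + \<alpha>2 + \<alpha>3) * y^2
          - (const \<alpha>0 * t - 1) * y - t + y^2 * z * w)"
  unfolding four_partial four_hamiltonian
  by (simp add: partial_rules) (simp add: algebra_simps power2_eq_square power3_eq_cube)

lemma four_partial_Y_hamiltonian:
  "4 * partial Y (hamiltonian \<alpha>0 \<alpha>1 \<alpha>2 \<alpha>3) =
     4 * t_inv2 * (3 * x^2 * y^2 - 2 * (t * x + const (2*\<alpha>1 + \<alpha>2 + \<alpha>3)) * x * y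
          - (const \<alpha>0 * t - 1) * x + const \<alpha>1 * const (\<alpha>1 + \<alpha>2 + \<alpha>3)
          + 2 * x * y * z * w - const \<alpha>1 * z * w)"
  unfolding four_partial four_hamiltonian
  by (simp add: partial_rules) (simp add: algebra_simps power2_eq_square power3_eq_cube)

lemma four_partial_Z_hamiltonian:
  "4 * partial Z (hamiltonian \<alpha>0 \<alpha>1 \<alpha>2 \<alpha>3) =
     2 * t_inv2 * (- z * w^4 + const \<alpha>3 * w^3 + 2 * t * z * w^2
          - ((const \<alpha>3 + 1) * t - 1) * w - t^2 * z + 2 * (x * y - const \<alpha>1) * y * w)"
  unfolding four_partial four_hamiltonian
  by (simp add: partial_rules) (simp add: algebra_simps power2_eq_square power3_eq_cube)

lemma four_partial_W_hamiltonian: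
  "4 * partial W (hamiltonian \<alpha>0 \<alpha>1 \<alpha>2 \<alpha>3) =
     2 * t_inv2 * (- 2 * z^2 * w^3 + 3 * const \<alpha>3 * z * w^2
          + (2 * t * z^2 - const \<alpha>3 ^ 2) * w
          - ((const \<alpha>3 + 1) * t - 1) * z + 2 * (x * y - const \<alpha>1) * y * z)"
  unfolding four_partial four_hamiltonian
  by (simp add: partial_rules) (simp add: algebra_simps power2_eq_square power3_eq_cube)

section \<open>The invariant divisors\<close>

text \<open>
  The cofactor is found by collecting the terms with $x$, the terms with $z$ and the rest. With
  $s = w^2$ the rest has the form $(y + s - t)(Ay + Bs + D)$: the coefficients of $y^2$ and $s^2$ give
  $A = -(2a_1 + a_3)$ and $B = a_3$, and the constant term gives $D = 1 - t$. The coefficients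
  $-2a_1 = A + B$ of $ys$ and $1 - t - a_3t = -tB + D$ of $s$ then fit, and the coefficient
  $1 - a_0t$ of $y$ equals $-tA + D = 1 - (1 - 2a_1 - a_3)t$ by the relation between the parameters.
  The common factor 2 is what remains of the factor 4 when $-2t^{-2}$ is taken out of the derivative.
\<close>
lemma cofactor_identity:
  fixes x y z w t a0 a1 a3 :: "'a::comm_ring_1"
  assumes "a0 + 2 * a1 + a3 = 1"
  shows "2 * t^2
       + 2 * (2 * x * y^3 - 2 * t * x * y^2 - (2 * a1 + a3) * y^2
          - (a0 * t - 1) * y - t + y^2 * z * w)
       + 2 * w * (- z * w^4 + a3 * w^3 + 2 * t * z * w^2
          - ((a3 + 1) * t - 1) * w - t^2 * z + 2 * (x * y - a1) * y * w)
     = 2 * ((y + w^2 - t) *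
       (2 * x * y^2 + z * w * (y - w^2 + t) - (2 * a1 + a3) * y + a3 * w^2 + 1 - t))"
proof -
  have a0: "a0 = 1 - 2 * a1 - a3"
    using assms by (simp add: algebra_simps)
  show ?thesis
    unfolding a0 by (simp add: algebra_simps power2_eq_square power3_eq_cube power4_eq_xxxx)
qed

lemma invariant_divisor_x:
  assumes "\<alpha>1 = 0"
  shows "invariant_divisor (hamiltonian \<alpha>0 \<alpha>1 \<alpha>2 \<alpha>3) x"
proof -
  have flow: "flow_deriv (hamiltonian \<alpha>0 \<alpha>1 \<alpha>2 \<alpha>3) x = partial Y (hamiltonian \<alpha>0 \<alpha>1 \<alpha>2 \<alpha>3)"
    by (simp add: flow_deriv_def partial_Var)
  have factored: "4 * partial Y (hamiltonian \<alpha>0 \<alpha>1 \<alpha>2 \<alpha>3) =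
      x * (4 * t_inv2 * (3 * x * y^2 - 2 * (t * x + const (\<alpha>2 + \<alpha>3)) * y
          - (const \<alpha>0 * t - 1) + 2 * y * z * w))"
    unfolding four_partial_Y_hamiltonian using assms
    by (simp add: algebra_simps power2_eq_square)
  show ?thesis
    unfolding invariant_divisor_def flow
    by (rule dvd_if_dvd_4_mult) (simp only: factored dvd_triv_left)
qed

lemma invariant_divisor_z:
  assumes "\<alpha>3 = 0"
  shows "invariant_divisor (hamiltonian \<alpha>0 \<alpha>1 \<alpha>2 \<alpha>3) z"
proof -
  have flow: "flow_deriv (hamiltonian \<alpha>0 \<alpha>1 \<alpha>2 \<alpha>3) z = partial W (hamiltonian \<alpha>0 \<alpha>1 \<alpha>2 \<alpha>3)"
    by (simp add: flow_deriv_def partial_Var)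
  have factored: "4 * partial W (hamiltonian \<alpha>0 \<alpha>1 \<alpha>2 \<alpha>3) =
      z * (2 * t_inv2 * (- 2 * z * w^3 + 2 * t * z * w - (t - 1) + 2 * (x * y - const \<alpha>1) * y))"
    unfolding four_partial_W_hamiltonian using assms
    by (simp add: algebra_simps power2_eq_square)
  show ?thesis
    unfolding invariant_divisor_def flow
    by (rule dvd_if_dvd_4_mult) (simp only: factored dvd_triv_left)
qed

lemma invariant_divisor_y_w:
  assumes "\<alpha>0 + 2 * \<alpha>1 + 2 * \<alpha>2 + \<alpha>3 = 1" and "\<alpha>2 = 0"
  shows "invariant_divisor (hamiltonian \<alpha>0 \<alpha>1 \<alpha>2 \<alpha>3) (y + w^2 - t)"
proof -
  let ?H = "hamiltonian \<alpha>0 \<alpha>1 \<alpha>2 \<alpha>3" and ?f = "y + w^2 - t"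
  have "const (\<alpha>0 + 2 * \<alpha>1 + \<alpha>3) = 1"
    using assms by simp
  then have params: "const \<alpha>0 + 2 * const \<alpha>1 + const \<alpha>3 = 1"
    by (simp add: const_add const_mult)
  have flow: "flow_deriv ?H ?f = - 1 - partial X ?H - 2 * w * partial Z ?H"
    by (simp add: flow_deriv_def partial_rules partial_t_add partial_t_diff)
  \<comment> \<open>Writing the time derivative 1 of $t$ as $t^{-2}t^2$ gives all terms the factor $t^{-2}$.\<close>
  have "4 * flow_deriv ?H ?f
      = - 4 * (t_inv2 * t^2) - 4 * partial X ?H - 2 * w * (4 * partial Z ?H)"
    unfolding flow Coeff_inverse_tvar by (simp add: algebra_simps)
  also have "\<dots> = - 2 * t_inv2 * (2 * t^2
       + 2 * (2 * x * y^3 - 2 * t * x * y^2 - (2 * const \<alpha>1 + const \<alpha>3) * y^2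
          - (const \<alpha>0 * t - 1) * y - t + y^2 * z * w)
       + 2 * w * (- z * w^4 + const \<alpha>3 * w^3 + 2 * t * z * w^2
          - ((const \<alpha>3 + 1) * t - 1) * w - t^2 * z + 2 * (x * y - const \<alpha>1) * y * w))"
    unfolding four_partial_X_hamiltonian four_partial_Z_hamiltonian
    using assms(2) by (simp add: const_add const_mult) (simp add: algebra_simps)
  finally have factored: "4 * flow_deriv ?H ?f = \<dots>" .
  have "?f dvd 4 * flow_deriv ?H ?f"
    unfolding factored cofactor_identity[OF params] by (intro dvd_mult dvd_triv_left)
  then show ?thesis
    unfolding invariant_divisor_def by (rule dvd_if_dvd_4_mult)
qed

theorem proposition3p4:
  fixes \<alpha>0 \<alpha>1 \<alpha>2 \<alpha>3 :: complex
  assumes "\<alpha>0 + 2 * \<alpha>1 + 2 * \<alpha>2 + \<alpha>3 = 1"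
  shows "(\<alpha>1 = 0 \<longrightarrow> invariant_divisor (hamiltonian \<alpha>0 \<alpha>1 \<alpha>2 \<alpha>3) (Var X)) \<and>
         (\<alpha>2 = 0 \<longrightarrow> invariant_divisor (hamiltonian \<alpha>0 \<alpha>1 \<alpha>2 \<alpha>3) (Var Y + Var W ^ 2 - Coeff tvar)) \<and>
         (\<alpha>3 = 0 \<longrightarrow> invariant_divisor (hamiltonian \<alpha>0 \<alpha>1 \<alpha>2 \<alpha>3) (Var Z))"
  using invariant_divisor_x invariant_divisor_y_w[OF assms] invariant_divisor_z
  by (intro conjI impI)

end
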